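(* Let $K=SU(2)$, $\lambda\in\mathfrak{k}^*$ and $s>0$. Write $$E_s(\lambda)=\begin{pmatrix}a&u+\sqrt{-1}\,v\\0&a^{-1}\end{pmatrix}\in AN,\qquad a>0,\ u,v\in\mathbb{R}.$$ Regard the basis elements $x,y,t$ of $\mathfrak{su}(2)$ as elements of $T_{(e,\lambda)}(T^*K)\cong T_eK\times T_\lambda\mathfrak{k}^*\cong\mathfrak{k}\times\mathfrak{k}^*$ (via the first factor). Then $$\mathcal{D}(\omega_{can})_{(e,\lambda)}(x,y)=\frac{a^{-2}}{2s}\big(u^2+v^2-a^2+a^{-2}\big),\quad\mathcal{D}(\omega_{can})_{(e,\lambda)}(y,t)=\frac{a^{-1}v}{s},\quad\mathcal{D}(\omega_{can})_{(e,\lambda)}(x,t)=\frac{a^{-1}u}{s}.$$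
   Context: $x=\frac1{2\sqrt2}\begin{pmatrix}0&1\\-1&0\end{pmatrix}$, $y=\frac{\sqrt{-1}}{2\sqrt2}\begin{pmatrix}0&1\\1&0\end{pmatrix}$, $t=\frac{\sqrt{-1}}{2\sqrt2}\begin{pmatrix}1&0\\0&-1\end{pmatrix}$ is a basis of $\mathfrak{su}(2)$, orthonormal for $(X,Y)=-4\operatorname{Tr}(XY)$, with dual basis $x^*,y^*,t^*$ of $\mathfrak{su}(2)^*$. $AN\subset SL_2(\mathbb{C})$ is the group of upper triangular matrices of determinant one with positive real diagonal; $\langle X,Y\rangle_s=-\frac1s\operatorname{Im}(4\operatorname{Tr}(XY))$; $\Theta^L$ is the left-invariant Maurer-Cartan form on $AN$. $\phi$ sends $x^*,y^*,t^*$ to $x,y,t$; $f\colon AN\to\exp(\sqrt{-1}\,\mathfrak{su}(2))$ is the diffeomorphism $f(b)=b\,\overline b^T$; $E_s(\lambda)=f^{-1}(\exp(2s\sqrt{-1}\,\phi(\lambda)))$. $T^*K\cong K\times\mathfrak{k}^*$ via left-invariant $1$-forms; $\omega_{can}=-d\theta_{taut}$; $\mu_L(k,\xi)=\mathrm{Ad}_k^*\xi$. $\Omega^s$ is a closed $2$-form on $\mathfrak{k}^*$ with $\Omega^s(X_{\mathfrak{k}^*},\cdot)=E_s^*\langle\Theta^L,X\rangle_s-d\langle\cdot,X\rangle$ for all $X\in\mathfrak{k}$ ($X_{\mathfrak{k}^*}$ generates the coadjoint action), and $\mathcal{D}(\omega_{can})=\omega_{can}+\mu_L^*\Omega^s$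.
   Formalization: With f(b)=b·b̄ᵀ as printed and the left-invariant Θ^L, no 2-form Ω^s satisfies the required contraction identity, so the claim is vacuous; the formal theorem also allows f(b)=b̄ᵀ·b, for which the three stated values are proved. *)

theory Defs
  imports "HOL-Analysis.Analysis"
begin

type_synonym mat2 = "complex^2^2"

definition mat2 :: "complex \<Rightarrow> complex \<Rightarrow> complex \<Rightarrow> complex \<Rightarrow> mat2" where
  "mat2 p q r w = vector [vector [p, q], vector [r, w]]"

definition cscale :: "complex \<Rightarrow> mat2 \<Rightarrow> mat2" where
  "cscale c A = (\<chi> i j. c * A $ i $ j)"

definition conj_transpose :: "mat2 \<Rightarrow> mat2" where
  "conj_transpose A = (\<chi> i j. cnj (A $ j $ i))"

(* The library exp does not apply: vectors carry the componentwise product, not the matrix product. *)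
definition mexp :: "mat2 \<Rightarrow> mat2" where
  "mexp A = (\<Sum>n. (1 / fact n) *\<^sub>R (((**) A ^^ n) (mat 1)))"

lemma mat2_nth [simp]:
  "mat2 p q r w $ 1 $ 1 = p" "mat2 p q r w $ 1 $ 2 = q"
  "mat2 p q r w $ 2 $ 1 = r" "mat2 p q r w $ 2 $ 2 = w"
  by (simp_all add: mat2_def)

definition AN :: "mat2 set" where
  "AN = {b. b $ 2 $ 1 = 0 \<and> det b = 1 \<and> (\<forall>i. b $ i $ i \<in> \<real> \<and> 0 < Re (b $ i $ i))}"


subsection \<open>The group SU(2)\<close>

typedef SU2 = "{k :: mat2. k ** conj_transpose k = mat 1 \<and> det k = 1}"
  morphisms mat_of_SU2 SU2_of
  by (rule exI[of _ "mat 1"])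
    (simp add: conj_transpose_def mat_def matrix_matrix_mult_def vec_eq_iff forall_2 sum_2 det_2)

setup_lifting type_definition_SU2

instantiation SU2 :: monoid_mult
begin

lift_definition one_SU2 :: SU2 is "mat 1"
  by (simp add: conj_transpose_def mat_def matrix_matrix_mult_def vec_eq_iff forall_2 sum_2 det_2)
lift_definition times_SU2 :: "SU2 \<Rightarrow> SU2 \<Rightarrow> SU2" is "(**)"
proof -
  fix k l :: mat2
  assume k: "k ** conj_transpose k = mat 1 \<and> det k = 1"
    and l: "l ** conj_transpose l = mat 1 \<and> det l = 1"
  have "conj_transpose (k ** l) = conj_transpose l ** conj_transpose k"
    by (simp add: conj_transpose_def matrix_matrix_mult_def vec_eq_iff sum_2 mult.commute)
  then have "(k ** l) ** conj_transpose (k ** l) = k ** (l ** conj_transpose l) ** conj_transpose k"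
    by (simp add: matrix_mul_assoc)
  then show "(k ** l) ** conj_transpose (k ** l) = mat 1 \<and> det (k ** l) = 1"
    using k l by (simp add: det_mul)
qed

instance
  by standard (transfer; simp add: matrix_mul_assoc)+

end

lift_definition SU2_inv :: "SU2 \<Rightarrow> SU2" is conj_transpose
proof -
  fix k :: mat2
  assume k: "k ** conj_transpose k = mat 1 \<and> det k = 1"
  have "conj_transpose (conj_transpose k) = k"
    by (simp add: conj_transpose_def vec_eq_iff)
  moreover have "conj_transpose k ** k = mat 1"
    using k matrix_left_right_inverse by blast
  moreover have "det (conj_transpose k) = cnj (det k)"
    by (simp add: det_2 conj_transpose_def)
  ultimately show "conj_transpose k ** conj_transpose (conj_transpose k) = mat 1 \<and> det (conj_transpose k) = 1"
    using k by simp
qed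

lemma SU2_inv: "k * SU2_inv k = 1" "SU2_inv k * k = 1"
proof -
  show 1: "k * SU2_inv k = 1"
    by transfer (rule conjunct1)
  show "SU2_inv k * k = 1"
    using 1 unfolding mat_of_SU2_inject[symmetric] times_SU2.rep_eq one_SU2.rep_eq
    by (rule iffD1[OF matrix_left_right_inverse])
qed


subsection \<open>The Lie algebra su(2) and its dual\<close>

typedef su2 = "{A :: mat2. conj_transpose A = - A \<and> trace A = 0}"
  morphisms mat_of su2_of
  by (rule exI[of _ 0]) (simp add: conj_transpose_def trace_def vec_eq_iff)

setup_lifting type_definition_su2

instantiation su2 :: real_vector
begin

lift_definition zero_su2 :: su2 is 0
  by (simp add: conj_transpose_def trace_def vec_eq_iff)
lift_definition plus_su2 :: "su2 \<Rightarrow> su2 \<Rightarrow> su2" is "(+)"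
  by (simp add: conj_transpose_def trace_def vec_eq_iff sum.distrib)
lift_definition minus_su2 :: "su2 \<Rightarrow> su2 \<Rightarrow> su2" is "(-)"
  by (simp add: conj_transpose_def trace_def vec_eq_iff sum_subtractf)
lift_definition uminus_su2 :: "su2 \<Rightarrow> su2" is uminus
  by (simp add: conj_transpose_def trace_def vec_eq_iff sum_negf)
lift_definition scaleR_su2 :: "real \<Rightarrow> su2 \<Rightarrow> su2" is scaleR
  by (simp add: conj_transpose_def trace_def vec_eq_iff flip: scaleR_right.sum)

instance
  by standard (transfer; simp add: algebra_simps)+

end

lemma mat_of_entries:
  "mat_of X $ 2 $ 1 = - cnj (mat_of X $ 1 $ 2)"
  "mat_of X $ 2 $ 2 = - (mat_of X $ 1 $ 1)"
  "Re (mat_of X $ 1 $ 1) = 0"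
proof -
  have h: "conj_transpose (mat_of X) = - mat_of X" "trace (mat_of X) = 0"
    using mat_of[of X] by auto
  have e: "cnj (mat_of X $ j $ i) = - (mat_of X $ i $ j)" for i j
    using h(1) by (simp add: conj_transpose_def vec_eq_iff)
  show "mat_of X $ 2 $ 1 = - cnj (mat_of X $ 1 $ 2)"
    using e[of 1 2] by simp
  show "mat_of X $ 2 $ 2 = - (mat_of X $ 1 $ 1)"
    using h(2) by (simp add: trace_def sum_2 eq_neg_iff_add_eq_0 add.commute)
  show "Re (mat_of X $ 1 $ 1) = 0"
    using arg_cong[OF e[of 1 1], of Re] by simp
qed

instantiation su2 :: real_inner
begin

definition inner_su2 :: "su2 \<Rightarrow> su2 \<Rightarrow> real" where
  "inner_su2 X Y = Re (- 4 * trace (mat_of X ** mat_of Y))"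
definition norm_su2 :: "su2 \<Rightarrow> real" where
  "norm_su2 X = sqrt (inner X X)"
definition dist_su2 :: "su2 \<Rightarrow> su2 \<Rightarrow> real" where
  "dist_su2 X Y = norm (X - Y)"
definition sgn_su2 :: "su2 \<Rightarrow> su2" where
  "sgn_su2 X = X /\<^sub>R norm X"
definition uniformity_su2 :: "(su2 \<times> su2) filter" where
  "uniformity_su2 = (INF e\<in>{0 <..}. principal {(x, y). dist x y < e})"
definition open_su2 :: "su2 set \<Rightarrow> bool" where
  "open_su2 U = (\<forall>x\<in>U. eventually (\<lambda>(x', y). x' = x \<longrightarrow> y \<in> U) uniformity)"

lemma inner_su2_entries:
  fixes X Y :: su2
  shows "inner X Y = 8 * (Im (mat_of X $ 1 $ 1) * Im (mat_of Y $ 1 $ 1)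
      + Re (mat_of X $ 1 $ 2) * Re (mat_of Y $ 1 $ 2)
      + Im (mat_of X $ 1 $ 2) * Im (mat_of Y $ 1 $ 2))"
  by (simp add: inner_su2_def trace_def matrix_matrix_mult_def sum_2 mat_of_entries algebra_simps)

lemma su2_eq_iff:
  "X = Y \<longleftrightarrow> Im (mat_of X $ 1 $ 1) = Im (mat_of Y $ 1 $ 1) \<and> mat_of X $ 1 $ 2 = mat_of Y $ 1 $ 2"
  by (auto simp: mat_of_inject[symmetric] vec_eq_iff forall_2 mat_of_entries complex_eq_iff)

instance
proof
  fix X Y Z :: su2 and r :: real
  show "dist X Y = norm (X - Y)" by (rule dist_su2_def)
  show "sgn X = X /\<^sub>R norm X" by (rule sgn_su2_def)
  show "uniformity = (INF e\<in>{0 <..}. principal {(x, y). dist x (y::su2) < e})"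
    by (rule uniformity_su2_def)
  show "open U = (\<forall>x\<in>U. eventually (\<lambda>(x', y). x' = x \<longrightarrow> y \<in> U) uniformity)" for U :: "su2 set"
    by (rule open_su2_def)
  show "inner X Y = inner Y X" by (simp add: inner_su2_entries mult.commute)
  show "inner (X + Y) Z = inner X Z + inner Y Z"
    by (simp add: inner_su2_entries plus_su2.rep_eq algebra_simps)
  show "inner (r *\<^sub>R X) Y = r * inner X Y"
    by (simp add: inner_su2_entries scaleR_su2.rep_eq algebra_simps)
  show "0 \<le> inner X X" by (simp add: inner_su2_entries)
  have "inner X X = 0 \<longleftrightarrow> Im (mat_of X $ 1 $ 1) = 0 \<and> Re (mat_of X $ 1 $ 2) = 0 \<and> Im (mat_of X $ 1 $ 2) = 0"
    by (simp add: inner_su2_entries add_nonneg_eq_0_iff)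
  then show "(inner X X = 0) = (X = 0)"
    by (simp add: su2_eq_iff zero_su2.rep_eq complex_eq_iff)
  show "norm X = sqrt (inner X X)" by (rule norm_su2_def)
qed

end

definition su2_x :: su2 where
  "su2_x = su2_of (cscale (1 / (2 * sqrt 2)) (mat2 0 1 (-1) 0))"
definition su2_y :: su2 where
  "su2_y = su2_of (cscale (\<i> / (2 * sqrt 2)) (mat2 0 1 1 0))"
definition su2_t :: su2 where
  "su2_t = su2_of (cscale (\<i> / (2 * sqrt 2)) (mat2 1 0 0 (-1)))"

lemma mat_of_basis:
  "mat_of su2_x = cscale (1 / (2 * sqrt 2)) (mat2 0 1 (-1) 0)"
  "mat_of su2_y = cscale (\<i> / (2 * sqrt 2)) (mat2 0 1 1 0)"
  "mat_of su2_t = cscale (\<i> / (2 * sqrt 2)) (mat2 1 0 0 (-1))"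
  unfolding su2_x_def su2_y_def su2_t_def
  by (rule su2_of_inverse,
      simp add: conj_transpose_def cscale_def trace_def vec_eq_iff forall_2 sum_2 del: of_real_mult)+

lemma basis_entries:
  "mat_of su2_x $ 1 $ 1 = 0" "mat_of su2_x $ 1 $ 2 = of_real (1 / (2 * sqrt 2))"
  "mat_of su2_y $ 1 $ 1 = 0" "mat_of su2_y $ 1 $ 2 = \<i> * of_real (1 / (2 * sqrt 2))"
  "mat_of su2_t $ 1 $ 1 = \<i> * of_real (1 / (2 * sqrt 2))" "mat_of su2_t $ 1 $ 2 = 0"
  by (simp_all add: mat_of_basis cscale_def)

instantiation su2 :: euclidean_space
begin

definition Basis_su2 :: "su2 set" where
  "Basis_su2 = {su2_x, su2_y, su2_t}"

instance
proof
  define c :: real where "c = 1 / (2 * sqrt 2)"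
  have c: "8 * (c * c) = 1" "c \<noteq> 0"
    by (simp_all add: c_def)
  note e = inner_su2_entries basis_entries[folded c_def]
  have o: "inner su2_x su2_x = 1" "inner su2_y su2_y = 1" "inner su2_t su2_t = 1"
    "inner su2_x su2_y = 0" "inner su2_y su2_x = 0" "inner su2_x su2_t = 0"
    "inner su2_t su2_x = 0" "inner su2_y su2_t = 0" "inner su2_t su2_y = 0"
    using c by (simp_all add: e)
  show "(Basis :: su2 set) \<noteq> {}" "finite (Basis :: su2 set)"
    by (simp_all add: Basis_su2_def)
  show "inner u v = (if u = v then 1 else 0)" if "u \<in> Basis" "v \<in> Basis" for u v :: su2
    using that o unfolding Basis_su2_def by force
  show "(\<forall>u\<in>Basis. inner X u = 0) = (X = 0)" for X :: su2
  proof -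
    have "(\<forall>u\<in>Basis. inner X u = 0) \<longleftrightarrow>
        Re (mat_of X $ 1 $ 2) = 0 \<and> Im (mat_of X $ 1 $ 2) = 0 \<and> Im (mat_of X $ 1 $ 1) = 0"
      using c(2) by (simp add: Basis_su2_def e)
    then show ?thesis
      by (auto simp: su2_eq_iff zero_su2.rep_eq complex_eq_iff)
  qed
qed

end

definition bracket :: "su2 \<Rightarrow> su2 \<Rightarrow> su2" where
  "bracket X Y = su2_of (mat_of X ** mat_of Y - mat_of Y ** mat_of X)"

type_synonym su2_dual = "su2 \<Rightarrow>\<^sub>L real"

(* The isomorphism taking the dual basis of (x, y, t) to (x, y, t); the coordinates of a
   functional in the dual basis are its values on x, y, t. *)
definition \<phi> :: "su2_dual \<Rightarrow> su2" where
  "\<phi> \<xi> = blinfun_apply \<xi> su2_x *\<^sub>R su2_x + blinfun_apply \<xi> su2_y *\<^sub>R su2_y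
     + blinfun_apply \<xi> su2_t *\<^sub>R su2_t"

definition SU2_exp :: "su2 \<Rightarrow> SU2" where
  "SU2_exp X = SU2_of (mexp (mat_of X))"

definition Ad :: "SU2 \<Rightarrow> su2 \<Rightarrow> su2" where
  "Ad k X = su2_of (mat_of_SU2 k ** mat_of X ** mat_of_SU2 (SU2_inv k))"

(* Left coadjoint action. *)
definition coAd :: "SU2 \<Rightarrow> su2_dual \<Rightarrow> su2_dual" where
  "coAd k \<xi> = Blinfun (\<lambda>X. blinfun_apply \<xi> (Ad (SU2_inv k) X))"

definition coad_field :: "su2 \<Rightarrow> su2_dual \<Rightarrow> su2_dual" where
  "coad_field X \<xi> = vector_derivative (\<lambda>r. coAd (SU2_exp (r *\<^sub>R X)) \<xi>) (at 0)"


subsection \<open>Differential forms on the dual\<close>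

(* On a finite-dimensional space this is k-fold continuous differentiability. *)
primrec C_k :: "nat \<Rightarrow> ('a::real_normed_vector \<Rightarrow> real) \<Rightarrow> bool" where
  "C_k 0 g \<longleftrightarrow> continuous_on UNIV g"
| "C_k (Suc n) g \<longleftrightarrow> (\<forall>z. g differentiable (at z)) \<and>
     (\<forall>v. C_k n (\<lambda>z. frechet_derivative g (at z) v))"

definition two_form :: "('a::real_normed_vector \<Rightarrow> 'a \<Rightarrow> 'a \<Rightarrow> real) \<Rightarrow> bool" where
  "two_form \<Omega> \<longleftrightarrow> (\<forall>z. bilinear (\<Omega> z) \<and> (\<forall>v. \<Omega> z v v = 0)) \<and>
     (\<forall>v w n. C_k n (\<lambda>z. \<Omega> z v w))"

definition ext_deriv2 ::
  "('a::real_normed_vector \<Rightarrow> 'a \<Rightarrow> 'a \<Rightarrow> real) \<Rightarrow> 'a \<Rightarrow> 'a \<Rightarrow> 'a \<Rightarrow> 'a \<Rightarrow> real" where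
  "ext_deriv2 \<Omega> z v1 v2 v3 =
     frechet_derivative (\<lambda>z. \<Omega> z v2 v3) (at z) v1
   - frechet_derivative (\<lambda>z. \<Omega> z v1 v3) (at z) v2
   + frechet_derivative (\<lambda>z. \<Omega> z v1 v2) (at z) v3"

definition closed_two_form :: "('a::real_normed_vector \<Rightarrow> 'a \<Rightarrow> 'a \<Rightarrow> real) \<Rightarrow> bool" where
  "closed_two_form \<Omega> \<longleftrightarrow> two_form \<Omega> \<and> (\<forall>z v1 v2 v3. ext_deriv2 \<Omega> z v1 v2 v3 = 0)"


subsection \<open>The map from the dual to AN and the forms it induces\<close>

definition E_map :: "(mat2 \<Rightarrow> mat2) \<Rightarrow> real \<Rightarrow> su2_dual \<Rightarrow> mat2" where
  "E_map f s \<xi> = inv_into AN f (mexp (cscale (2 * s * \<i>) (mat_of (\<phi> \<xi>))))"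

(* Left-invariant Maurer-Cartan form on AN; V is a tangent vector at b. *)
definition MC_left :: "mat2 \<Rightarrow> mat2 \<Rightarrow> mat2" where
  "MC_left b V = matrix_inv b ** V"

definition pairing :: "real \<Rightarrow> mat2 \<Rightarrow> mat2 \<Rightarrow> real" where
  "pairing s Z X = - (1 / s) * Im (4 * trace (Z ** X))"

definition pullback_MC :: "(mat2 \<Rightarrow> mat2) \<Rightarrow> real \<Rightarrow> su2 \<Rightarrow> su2_dual \<Rightarrow> su2_dual \<Rightarrow> real" where
  "pullback_MC f s X \<xi> \<eta> =
     pairing s (MC_left (E_map f s \<xi>) (frechet_derivative (E_map f s) (at \<xi>) \<eta>)) (mat_of X)"

definition moment_condition ::
  "(mat2 \<Rightarrow> mat2) \<Rightarrow> real \<Rightarrow> (su2_dual \<Rightarrow> su2_dual \<Rightarrow> su2_dual \<Rightarrow> real) \<Rightarrow> bool" where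
  "moment_condition f s \<Omega> \<longleftrightarrow> (\<forall>X \<xi> \<eta>. \<Omega> \<xi> (coad_field X \<xi>) \<eta> =
     pullback_MC f s X \<xi> \<eta>
     - frechet_derivative (\<lambda>\<zeta>. blinfun_apply \<zeta> X) (at \<xi>) \<eta>)"

(* With f b = b b* and the left-invariant Maurer-Cartan form, no 2-form satisfies
   moment_condition for s > 0: contracting the right-hand side with coad_field X does not
   give 0.  With f b = b* b such closed forms exist.  Both conventions are kept here. *)
definition herm_square :: "mat2 \<Rightarrow> mat2" where
  "herm_square b = b ** conj_transpose b"

definition herm_square' :: "mat2 \<Rightarrow> mat2" where
  "herm_square' b = conj_transpose b ** b"


subsection \<open>The cotangent bundle of SU(2) in the left trivialization\<close>

(* A point (k, \<xi>) of K x k* stands for the covector kX \<mapsto> \<xi>(X) at k.  A tangent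
   vector (X, \<eta>) at (k, \<xi>) stands for (kX, \<eta>), the velocity at r = 0 of the
   curve (k exp(rX), \<xi> + r\<eta>). *)
type_synonym cot_point = "SU2 \<times> su2_dual"
type_synonym cot_tangent = "su2 \<times> su2_dual"

definition tderiv :: "(cot_point \<Rightarrow> 'b::real_normed_vector) \<Rightarrow> cot_point \<Rightarrow> cot_tangent \<Rightarrow> 'b" where
  "tderiv F p v = vector_derivative
     (\<lambda>r. F (fst p * SU2_exp (r *\<^sub>R fst v), snd p + r *\<^sub>R snd v)) (at 0)"

definition tautological :: "cot_point \<Rightarrow> cot_tangent \<Rightarrow> real" where
  "tautological p v = blinfun_apply (snd p) (fst v)"

(* Cartan's formula d\<alpha>(V,W) = V \<alpha>(W) - W \<alpha>(V) - \<alpha>([V,W]) on left-invariant vector fields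
   of K x k*, whose bracket is [(X,\<eta>),(Y,\<zeta>)] = ([X,Y],0). *)
definition ext_deriv1 ::
  "(cot_point \<Rightarrow> cot_tangent \<Rightarrow> real) \<Rightarrow> cot_point \<Rightarrow> cot_tangent \<Rightarrow> cot_tangent \<Rightarrow> real" where
  "ext_deriv1 \<alpha> p v w = tderiv (\<lambda>q. \<alpha> q w) p v - tderiv (\<lambda>q. \<alpha> q v) p w
     - \<alpha> p (bracket (fst v) (fst w), 0)"

definition \<omega>_can :: "cot_point \<Rightarrow> cot_tangent \<Rightarrow> cot_tangent \<Rightarrow> real" where
  "\<omega>_can p v w = - ext_deriv1 tautological p v w"

definition \<mu>_L :: "cot_point \<Rightarrow> su2_dual" where
  "\<mu>_L p = coAd (fst p) (snd p)"

definition delinearize ::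
  "(su2_dual \<Rightarrow> su2_dual \<Rightarrow> su2_dual \<Rightarrow> real) \<Rightarrow> (cot_point \<Rightarrow> cot_tangent \<Rightarrow> cot_tangent \<Rightarrow> real)
     \<Rightarrow> cot_point \<Rightarrow> cot_tangent \<Rightarrow> cot_tangent \<Rightarrow> real" where
  "delinearize \<Omega> \<omega> p v w = \<omega> p v w + \<Omega> (\<mu>_L p) (tderiv \<mu>_L p v) (tderiv \<mu>_L p w)"

end

theory Submission
  imports Defs
begin

text \<open>
  At \<open>(e, \<lambda>)\<close> the canonical form is \<open>\<lambda>[X, Y]\<close>, and so is \<open>d\<langle>\<cdot>, X\<rangle>\<close> on the coadjoint vector of
  \<open>Y\<close>. The moment condition makes them cancel, which leaves the pullback of \<open>\<langle>\<Theta>\<^sup>L, X\<rangle>\<^sub>s\<close> evaluated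
  on that vector. Since \<open>(2 s \<i> \<phi>(\<lambda>))\<^sup>2\<close> is a scalar \<open>q\<close>, the exponential is \<open>C + 2 s \<i> S \<phi>(\<lambda>)\<close>
  with \<open>C\<close> and \<open>S\<close> entire in \<open>q\<close> and \<open>C\<^sup>2 - q S\<^sup>2 = 1\<close>; hence \<open>E\<^sub>s\<close> is explicit and smooth. As \<open>q\<close>
  is constant on coadjoint orbits, the derivatives of \<open>C\<close> and \<open>S\<close> do not enter. For \<open>f(b) = b b\<^sup>*\<close> the
  same computation contradicts \<open>\<Omega>(v, v) = 0\<close>.
\<close>


subsection \<open>Exponentials of matrices with scalar square\<close>

text \<open>\<open>cosh (\<surd>q)\<close> and \<open>sinh (\<surd>q) / \<surd>q\<close> as power series in \<open>q\<close>, which covers both signs of \<open>q\<close>: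
  squares are negative in \<open>su(2)\<close> and positive in \<open>\<i> su(2)\<close>.\<close>

definition cosh_sqrt :: "real \<Rightarrow> real" where
  "cosh_sqrt q = (\<Sum>n. inverse (fact (2 * n)) * q ^ n)"

definition sinhc_sqrt :: "real \<Rightarrow> real" where
  "sinhc_sqrt q = (\<Sum>n. inverse (fact (2 * n + 1)) * q ^ n)"

text \<open>Since n! <= (g n)!, the exponential series at \<open>\<bar>q\<bar>\<close> dominates;
  the indices 2n and 2n+1 both qualify.\<close>

lemma summable_inverse_fact_power:
  fixes q :: real
  assumes "\<And>n. n \<le> g n"
  shows "summable (\<lambda>n. inverse (fact (g n)) * q ^ n)"
proof (rule summable_comparison_test'[OF summable_exp[of "\<bar>q\<bar>"], of 0])
  fix n :: nat
  have "(fact n :: real) \<le> fact (g n)"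
    by (rule fact_mono[OF assms])
  then show "norm (inverse (fact (g n)) * q ^ n) \<le> inverse (fact n) * \<bar>q\<bar> ^ n"
    by (simp add: abs_mult power_abs mult_right_mono le_imp_inverse_le)
qed

lemma cosh_sqrt_sums: "(\<lambda>n. inverse (fact (2 * n)) * q ^ n) sums cosh_sqrt q"
  unfolding cosh_sqrt_def by (rule summable_sums[OF summable_inverse_fact_power]) simp

lemma sinhc_sqrt_sums: "(\<lambda>n. inverse (fact (2 * n + 1)) * q ^ n) sums sinhc_sqrt q"
  unfolding sinhc_sqrt_def by (rule summable_sums[OF summable_inverse_fact_power]) simp

lemma cosh_sqrt_0 [simp]: "cosh_sqrt 0 = 1"
  by (simp add: cosh_sqrt_def)

lemma sinhc_sqrt_0 [simp]: "sinhc_sqrt 0 = 1"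
  by (simp add: sinhc_sqrt_def)

text \<open>The sign of q matters: for q < 0 the function is a cosine and changes sign.\<close>

lemma cosh_sqrt_pos: "0 < cosh_sqrt q" if "0 \<le> q"
proof -
  have "(\<Sum>n<1. inverse (fact (2 * n)) * q ^ n) \<le> cosh_sqrt q"
    unfolding cosh_sqrt_def using that
    by (intro sum_le_suminf sums_summable[OF cosh_sqrt_sums]) auto
  then show ?thesis by simp
qed

lemma sinhc_sqrt_pos: "0 < sinhc_sqrt q" if "0 \<le> q"
proof -
  have "(\<Sum>n<1. inverse (fact (2 * n + 1)) * q ^ n) \<le> sinhc_sqrt q"
    unfolding sinhc_sqrt_def using that
    by (intro sum_le_suminf sums_summable[OF sinhc_sqrt_sums]) auto
  then show ?thesis by simp
qed

text \<open>Termwise, (n+1) / (2n+2)! = 1 / (2 (2n+1)!).\<close>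

lemma cosh_sqrt_deriv: "(cosh_sqrt has_field_derivative sinhc_sqrt q / 2) (at q)"
proof -
  have "diffs (\<lambda>n. inverse (fact (2 * n)) :: real) = (\<lambda>n. inverse 2 * inverse (fact (2 * n + 1)))"
  proof
    fix n :: nat
    have "(fact (2 * Suc n) :: real) = 2 * real (Suc n) * fact (2 * n + 1)"
      by simp
    then show "diffs (\<lambda>n. inverse (fact (2 * n)) :: real) n = inverse 2 * inverse (fact (2 * n + 1))"
      by (simp add: diffs_def del: fact_Suc of_nat_Suc mult_Suc_right)
  qed
  then have "(\<Sum>n. diffs (\<lambda>n. inverse (fact (2 * n))) n * q ^ n) = sinhc_sqrt q / 2"
    unfolding sinhc_sqrt_def
    by (simp only: mult.assoc suminf_mult[OF sums_summable[OF sinhc_sqrt_sums]]) simp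
  moreover have "(cosh_sqrt has_field_derivative
      (\<Sum>n. diffs (\<lambda>n. inverse (fact (2 * n))) n * q ^ n)) (at q)"
    unfolding cosh_sqrt_def[abs_def]
    by (intro termdiffs_strong_converges_everywhere summable_inverse_fact_power) simp
  ultimately show ?thesis
    by (simp only:)
qed

text \<open>Termwise, (2n+1) / (2n+1)! = 1 / (2n)!. The relation replaces the quotient (C - S) /
  (2q), which has no meaning at q = 0.\<close>

lemma sinhc_sqrt_deriv:
  obtains d where "(sinhc_sqrt has_field_derivative d) (at q)"
    "sinhc_sqrt q + 2 * q * d = cosh_sqrt q"
proof -
  let ?c = "\<lambda>n. inverse (fact (2 * n + 1)) :: real"
  define d where "d = (\<Sum>n. diffs ?c n * q ^ n)"
  have D: "(sinhc_sqrt has_field_derivative d) (at q)"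
    using termdiffs_strong_converges_everywhere[OF summable_inverse_fact_power, of "\<lambda>n. 2 * n + 1" q]
    by (simp add: sinhc_sqrt_def[abs_def] d_def)
  have "summable (\<lambda>n. diffs ?c n * q ^ n)"
    by (rule termdiff_converges_all, rule summable_inverse_fact_power) simp
  \<comment> \<open>At n = 0 the truncated exponent is harmless because of the factor n.\<close>
  then have "(\<lambda>n. real n * ?c n * q ^ (n - Suc 0)) sums d"
    unfolding d_def by (rule diffs_equiv)
  from sums_mult[OF this, of "2 * q"] sinhc_sqrt_sums
  have "(\<lambda>n. ?c n * q ^ n + 2 * q * (real n * ?c n * q ^ (n - Suc 0))) sums (sinhc_sqrt q + 2 * q * d)"
    by (intro sums_add)
  moreover have "?c n * q ^ n + 2 * q * (real n * ?c n * q ^ (n - Suc 0)) = inverse (fact (2 * n)) * q ^ n" for n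
  proof (cases n)
    case (Suc k)
    have "?c n * q ^ n + 2 * q * (real n * ?c n * q ^ (n - Suc 0)) = real (2 * n + 1) * ?c n * q ^ n"
      by (simp add: Suc algebra_simps)
    also have "real (2 * n + 1) * ?c n = inverse (fact (2 * n))"
      by (simp add: inverse_mult_distrib del: of_nat_add of_nat_mult of_nat_Suc)
    finally show ?thesis .
  qed simp
  ultimately have "(\<lambda>n. inverse (fact (2 * n)) * q ^ n) sums (sinhc_sqrt q + 2 * q * d)"
    by (simp only:)
  then have "sinhc_sqrt q + 2 * q * d = cosh_sqrt q"
    using cosh_sqrt_sums by (rule sums_unique2)
  with D show thesis by (rule that)
qed

text \<open>The derivative is S (C - S - 2 q S') = 0, so the value at q = 0 decides. This unifies
  cosh^2 - sinh^2 = 1 and cos^2 + sin^2 = 1.\<close>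

lemma cosh_sqrt_sinhc_sqrt: "(cosh_sqrt q)\<^sup>2 - q * (sinhc_sqrt q)\<^sup>2 = 1"
proof -
  have "((\<lambda>q. (cosh_sqrt q)\<^sup>2 - q * (sinhc_sqrt q)\<^sup>2) has_field_derivative 0) (at q)" for q
  proof -
    obtain d where d: "(sinhc_sqrt has_field_derivative d) (at q)"
      and e: "sinhc_sqrt q + 2 * q * d = cosh_sqrt q"
      by (rule sinhc_sqrt_deriv)
    show ?thesis
      by (rule derivative_eq_intros cosh_sqrt_deriv d refl)+
        (simp add: power2_eq_square algebra_simps flip: e)
  qed
  then have "(cosh_sqrt q)\<^sup>2 - q * (sinhc_sqrt q)\<^sup>2 = (cosh_sqrt 0)\<^sup>2 - 0 * (sinhc_sqrt 0)\<^sup>2"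
    by (intro DERIV_isconst_all) blast
  then show ?thesis by simp
qed

text \<open>Even powers of A are multiples of the identity and odd powers multiples of A, so the
  exponential series splits into the two scalar series.\<close>

lemma mexp_square_scalar:
  assumes "A ** A = q *\<^sub>R mat 1"
  shows "mexp A = cosh_sqrt q *\<^sub>R mat 1 + sinhc_sqrt q *\<^sub>R A"
proof -
  have scale: "A ** (r *\<^sub>R B) = r *\<^sub>R (A ** B)" for r :: real and B :: mat2
    by (simp add: matrix_matrix_mult_def vec_eq_iff scaleR_sum_right)
  have pow: "((**) A ^^ (2 * n)) (mat 1) = q ^ n *\<^sub>R mat 1"
    "((**) A ^^ (2 * n + 1)) (mat 1) = q ^ n *\<^sub>R A" for n
    by (induction n) (simp_all add: scale assms mult.commute)
  \<comment> \<open>One formula for both parities, padded with zeros, so that the two scalar series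
    can be added.\<close>
  have pow': "((**) A ^^ n) (mat 1)
      = (if even n then q ^ (n div 2) else 0) *\<^sub>R mat 1
        + (if even n then 0 else q ^ ((n - 1) div 2)) *\<^sub>R A" for n
    using pow[of "n div 2"] by (cases "even n") (auto elim!: oddE simp del: funpow.simps)
  have "(\<lambda>n. if even n then inverse (fact (2 * (n div 2))) * q ^ (n div 2) else 0) sums cosh_sqrt q"
    using sums_if[OF sums_zero cosh_sqrt_sums] by simp
  moreover have "(\<lambda>n. if even n then 0
      else inverse (fact (2 * ((n - 1) div 2) + 1)) * q ^ ((n - 1) div 2)) sums sinhc_sqrt q"
    by (rule sums_if'[OF sinhc_sqrt_sums])
  ultimately have "(\<lambda>n.
      (if even n then inverse (fact (2 * (n div 2))) * q ^ (n div 2) else 0) *\<^sub>R (mat 1 :: mat2)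
      + (if even n then 0 else inverse (fact (2 * ((n - 1) div 2) + 1)) * q ^ ((n - 1) div 2)) *\<^sub>R A)
      sums (cosh_sqrt q *\<^sub>R mat 1 + sinhc_sqrt q *\<^sub>R A)"
    by (intro sums_add sums_scaleR_left)
  moreover have "(if even n then inverse (fact (2 * (n div 2))) * q ^ (n div 2) else 0) *\<^sub>R (mat 1 :: mat2)
      + (if even n then 0 else inverse (fact (2 * ((n - 1) div 2) + 1)) * q ^ ((n - 1) div 2)) *\<^sub>R A
      = (1 / fact n) *\<^sub>R ((**) A ^^ n) (mat 1)" for n
    by (cases "even n") (simp_all add: pow' inverse_eq_divide)
  ultimately show ?thesis
    unfolding mexp_def by (simp add: sums_iff)
qed

section \<open>Coordinates on su(2) and the exponential into SU(2)\<close>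

lemma mat_of_eq_mat2:
  obtains h :: real and z where "mat_of X = mat2 (\<i> * h) z (- cnj z) (- \<i> * h)"
proof
  show "mat_of X = mat2 (\<i> * complex_of_real (Im (mat_of X $ 1 $ 1))) (mat_of X $ 1 $ 2)
      (- cnj (mat_of X $ 1 $ 2)) (- \<i> * complex_of_real (Im (mat_of X $ 1 $ 1)))"
    by (simp add: vec_eq_iff forall_2 mat_of_entries complex_eq_iff)
qed

lemma mat2_mult:
  "mat2 p q r w ** mat2 p' q' r' w' =
     mat2 (p * p' + q * r') (p * q' + q * w') (r * p' + w * r') (r * q' + w * w')"
  by (simp add: vec_eq_iff forall_2 matrix_matrix_mult_def sum_2)

text \<open>Cayley-Hamilton for trace zero: the square is -det X, and det X = |X|^2 / 8 in the norm
  given by -4 Tr.\<close>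

lemma mat_of_square: "mat_of X ** mat_of X = - (inner X X / 8) *\<^sub>R mat 1"
proof -
  obtain h :: real and z where X: "mat_of X = mat2 (\<i> * h) z (- cnj z) (- \<i> * h)"
    by (rule mat_of_eq_mat2)
  show ?thesis
    by (simp add: X inner_su2_entries mat2_mult vec_eq_iff forall_2 mat_def complex_eq_iff field_simps)
qed

lemma mat_of_SU2_exp:
  "mat_of_SU2 (SU2_exp X)
     = cosh_sqrt (- (inner X X / 8)) *\<^sub>R mat 1 + sinhc_sqrt (- (inner X X / 8)) *\<^sub>R mat_of X"
proof -
  obtain h :: real and z where X: "mat_of X = mat2 (\<i> * h) z (- cnj z) (- \<i> * h)"
    by (rule mat_of_eq_mat2)
  define q where "q = - (inner X X / 8)"
  have q: "q = - (h\<^sup>2 + (Re z)\<^sup>2 + (Im z)\<^sup>2)"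
    by (simp add: q_def inner_su2_entries X power2_eq_square field_simps)
  have e: "mexp (mat_of X) = cosh_sqrt q *\<^sub>R mat 1 + sinhc_sqrt q *\<^sub>R mat_of X"
    unfolding q_def by (rule mexp_square_scalar[OF mat_of_square])
  \<comment> \<open>This one scalar identity yields both unitarity and determinant one.\<close>
  have "(cosh_sqrt q)\<^sup>2 + (h\<^sup>2 + (Re z)\<^sup>2 + (Im z)\<^sup>2) * (sinhc_sqrt q)\<^sup>2 = 1"
    using cosh_sqrt_sinhc_sqrt[of q] unfolding minus_equation_iff[THEN iffD1, OF q[symmetric], symmetric]
    by simp
  then have "mexp (mat_of X) \<in> {k. k ** conj_transpose k = mat 1 \<and> det k = 1}"
    unfolding e unfolding X
    by (simp add: vec_eq_iff forall_2 matrix_matrix_mult_def sum_2 conj_transpose_def mat_def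
        det_2 complex_eq_iff power2_eq_square algebra_simps)
  then show ?thesis
    unfolding SU2_exp_def q_def[symmetric] e[symmetric] by (rule SU2_of_inverse)
qed


subsection \<open>The coadjoint action\<close>

lemma mat_of_bracket: "mat_of (bracket X Y) = mat_of X ** mat_of Y - mat_of Y ** mat_of X"
  unfolding bracket_def
proof (rule su2_of_inverse)
  obtain h :: real and z where X: "mat_of X = mat2 (\<i> * h) z (- cnj z) (- \<i> * h)"
    by (rule mat_of_eq_mat2)
  obtain h' :: real and z' where Y: "mat_of Y = mat2 (\<i> * h') z' (- cnj z') (- \<i> * h')"
    by (rule mat_of_eq_mat2)
  show "mat_of X ** mat_of Y - mat_of Y ** mat_of X \<in> {A. conj_transpose A = - A \<and> trace A = 0}"
    by (simp add: X Y mat2_mult conj_transpose_def trace_def vec_eq_iff forall_2 sum_2 algebra_simps)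
qed

text \<open>The second-order term of exp(-rX) Y exp(rX). It stays in su(2): it is skew-Hermitian,
  and Tr(XYX) = Tr(X^2 Y) = 0 because X^2 is scalar.\<close>

definition sandwich :: "su2 \<Rightarrow> su2 \<Rightarrow> su2" where
  "sandwich X Y = su2_of (mat_of X ** mat_of Y ** mat_of X)"

lemma mat_of_sandwich: "mat_of (sandwich X Y) = mat_of X ** mat_of Y ** mat_of X"
  unfolding sandwich_def
proof (rule su2_of_inverse)
  obtain h :: real and z where X: "mat_of X = mat2 (\<i> * h) z (- cnj z) (- \<i> * h)"
    by (rule mat_of_eq_mat2)
  obtain h' :: real and z' where Y: "mat_of Y = mat2 (\<i> * h') z' (- cnj z') (- \<i> * h')"
    by (rule mat_of_eq_mat2)
  show "mat_of X ** mat_of Y ** mat_of X \<in> {A. conj_transpose A = - A \<and> trace A = 0}"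
    by (simp add: X Y mat2_mult conj_transpose_def trace_def vec_eq_iff forall_2 sum_2 algebra_simps)
qed

lemma bounded_linear_bracket [bounded_linear]: "bounded_linear (bracket X)"
  unfolding linear_conv_bounded_linear[symmetric]
  by (intro linearI)
    (simp_all add: su2_eq_iff mat_of_bracket plus_su2.rep_eq scaleR_su2.rep_eq
      matrix_matrix_mult_def sum_2 algebra_simps)

lemma bounded_linear_sandwich [bounded_linear]: "bounded_linear (sandwich X)"
  unfolding linear_conv_bounded_linear[symmetric]
  by (intro linearI)
    (simp_all add: su2_eq_iff mat_of_sandwich plus_su2.rep_eq scaleR_su2.rep_eq
      matrix_matrix_mult_def sum_2 algebra_simps)

lemma SU2_inv_inv [simp]: "SU2_inv (SU2_inv k) = k"
  by transfer (simp add: conj_transpose_def vec_eq_iff)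

text \<open>With \<open>X\<^sup>2\<close> scalar, \<open>exp (- r X) = C - S r X\<close>; expanding the conjugate of \<open>Y\<close> makes the
  dependence on \<open>r\<close> explicit.\<close>

lemma Ad_inv_SU2_exp:
  fixes X Y :: su2 and r :: real
  defines "q \<equiv> - (r\<^sup>2 * inner X X / 8)"
  shows "Ad (SU2_inv (SU2_exp (r *\<^sub>R X))) Y = (cosh_sqrt q)\<^sup>2 *\<^sub>R Y
    - (cosh_sqrt q * sinhc_sqrt q * r) *\<^sub>R bracket X Y - ((sinhc_sqrt q)\<^sup>2 * r\<^sup>2) *\<^sub>R sandwich X Y"
    (is "_ = ?W")
proof -
  obtain h :: real and z where X: "mat_of X = mat2 (\<i> * h) z (- cnj z) (- \<i> * h)"
    by (rule mat_of_eq_mat2)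
  obtain h' :: real and z' where Y: "mat_of Y = mat2 (\<i> * h') z' (- cnj z') (- \<i> * h')"
    by (rule mat_of_eq_mat2)
  have k: "mat_of_SU2 (SU2_exp (r *\<^sub>R X)) = cosh_sqrt q *\<^sub>R mat 1 + (sinhc_sqrt q * r) *\<^sub>R mat_of X"
    by (simp add: mat_of_SU2_exp q_def scaleR_su2.rep_eq power2_eq_square mult.assoc)
  have "mat_of_SU2 (SU2_inv (SU2_exp (r *\<^sub>R X))) ** mat_of Y ** mat_of_SU2 (SU2_exp (r *\<^sub>R X)) = mat_of ?W"
    unfolding SU2_inv.rep_eq k minus_su2.rep_eq scaleR_su2.rep_eq mat_of_bracket mat_of_sandwich X Y
    by (simp add: vec_eq_iff forall_2 matrix_matrix_mult_def sum_2 conj_transpose_def mat_def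
        complex_eq_iff power2_eq_square algebra_simps)
  then show ?thesis
    by (simp add: Ad_def mat_of_inverse)
qed

text \<open>As q is quadratic in r, the factors C and S are stationary at r = 0 with value 1. Of the
  three terms in \<open>Ad_inv_SU2_exp\<close> only the bracket has a first-order part.\<close>

lemma coad_field_apply: "blinfun_apply (coad_field X \<xi>) Y = - blinfun_apply \<xi> (bracket X Y)"
proof -
  define q where "q r = - (r\<^sup>2 * inner X X / 8)" for r :: real
  \<comment> \<open>With \<open>B\<close> and \<open>T\<close> in the dual, the orbit is a
    combination of three fixed vectors with scalar coefficients.\<close>
  define B where "B = \<xi> o\<^sub>L Blinfun (bracket X)"
  define T where "T = \<xi> o\<^sub>L Blinfun (sandwich X)"
  have B: "blinfun_apply B Y = blinfun_apply \<xi> (bracket X Y)" for Y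
    by (simp add: B_def bounded_linear_Blinfun_apply bounded_linear_bracket)
  have T: "blinfun_apply T Y = blinfun_apply \<xi> (sandwich X Y)" for Y
    by (simp add: T_def bounded_linear_Blinfun_apply bounded_linear_sandwich)
  have e: "coAd (SU2_exp (r *\<^sub>R X)) \<xi> = (cosh_sqrt (q r))\<^sup>2 *\<^sub>R \<xi>
      - (cosh_sqrt (q r) * sinhc_sqrt (q r) * r) *\<^sub>R B - ((sinhc_sqrt (q r))\<^sup>2 * r\<^sup>2) *\<^sub>R T" for r
  proof -
    have "(\<lambda>Y. blinfun_apply \<xi> (Ad (SU2_inv (SU2_exp (r *\<^sub>R X))) Y)) =
      blinfun_apply ((cosh_sqrt (q r))\<^sup>2 *\<^sub>R \<xi>
      - (cosh_sqrt (q r) * sinhc_sqrt (q r) * r) *\<^sub>R B - ((sinhc_sqrt (q r))\<^sup>2 * r\<^sup>2) *\<^sub>R T)"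
      by (simp add: fun_eq_iff Ad_inv_SU2_exp blinfun.bilinear_simps B T q_def)
    then show ?thesis
      by (simp add: coAd_def blinfun_apply_inverse)
  qed
  obtain d where d: "(sinhc_sqrt has_field_derivative d) (at 0)"
    by (rule sinhc_sqrt_deriv)
  have q': "(q has_field_derivative 0) (at 0)" "q 0 = 0"
    unfolding q_def by (auto intro!: derivative_eq_intros)
  have C: "((\<lambda>r. cosh_sqrt (q r)) has_field_derivative 0) (at 0)"
    and S: "((\<lambda>r. sinhc_sqrt (q r)) has_field_derivative 0) (at 0)"
    using DERIV_chain2[OF _ q'(1)] cosh_sqrt_deriv d q'(2) by (metis mult_zero_right)+
  have "((\<lambda>r. coAd (SU2_exp (r *\<^sub>R X)) \<xi>) has_vector_derivative - B) (at 0)"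
    unfolding e
    by (rule derivative_eq_intros C S refl)+ (simp add: q'(2))
  then show ?thesis
    by (simp add: coad_field_def vector_derivative_at B blinfun.bilinear_simps)
qed

text \<open>The vectors are 1 / sqrt 2 times a basis with [e1, e2] = e3 and its cyclic versions;
  this is the source of the factor.\<close>

lemma bracket_basis:
  "bracket su2_x su2_y = (1 / sqrt 2) *\<^sub>R su2_t" "bracket su2_y su2_x = - (1 / sqrt 2) *\<^sub>R su2_t"
  "bracket su2_y su2_t = (1 / sqrt 2) *\<^sub>R su2_x" "bracket su2_t su2_y = - (1 / sqrt 2) *\<^sub>R su2_x"
  "bracket su2_t su2_x = (1 / sqrt 2) *\<^sub>R su2_y" "bracket su2_x su2_t = - (1 / sqrt 2) *\<^sub>R su2_y"
  "bracket X X = 0"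
  by (simp_all add: su2_eq_iff mat_of_bracket scaleR_su2.rep_eq zero_su2.rep_eq uminus_su2.rep_eq mat_of_basis
      cscale_def matrix_matrix_mult_def sum_2 complex_eq_iff field_simps)

section \<open>The delinearized form at the identity\<close>

lemma coAd_one [simp]: "coAd 1 \<xi> = \<xi>"
proof -
  have "Ad (SU2_inv 1) X = X" for X
    using SU2_inv(1)[of 1] by (simp add: Ad_def one_SU2.rep_eq mat_of_inverse)
  then show ?thesis
    by (simp add: coAd_def blinfun_apply_inverse)
qed

lemma frechet_derivative_blinfun_apply:
  "frechet_derivative (\<lambda>\<zeta>. blinfun_apply \<zeta> v) (at \<xi>) = (\<lambda>\<zeta>. blinfun_apply \<zeta> v)"
  by (rule frechet_derivative_at[symmetric]) (auto intro!: derivative_eq_intros)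

text \<open>The moment condition is used on the coadjoint vector of Y. Its value at X is
  -\<xi>[Y, X] = \<xi>[X, Y], which enters with a minus sign and cancels the canonical form.\<close>

lemma delinearize_one:
  assumes "moment_condition f s \<Omega>"
  shows "delinearize \<Omega> \<omega>_can (1, \<xi>) (X, 0) (Y, 0) = pullback_MC f s X \<xi> (coad_field Y \<xi>)"
proof -
  have t: "tderiv \<mu>_L (1, \<xi>) (Z, 0) = coad_field Z \<xi>" for Z
    by (simp add: tderiv_def \<mu>_L_def coad_field_def)
  \<comment> \<open>On a fixed (Z, 0) the tautological form is constant along these curves, so
    Cartan's formula leaves only the bracket; its minus sign cancels the one in
    \<open>\<omega>_can\<close>.\<close>
  have "\<omega>_can (1, \<xi>) (X, 0) (Y, 0) = blinfun_apply \<xi> (bracket X Y)"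
    by (simp add: \<omega>_can_def ext_deriv1_def tderiv_def tautological_def)
  moreover have "bracket Y X = - bracket X Y"
    by (simp add: su2_eq_iff mat_of_bracket uminus_su2.rep_eq)
  ultimately show ?thesis
    using assms by (simp add: delinearize_def moment_condition_def t \<mu>_L_def coad_field_apply
        frechet_derivative_blinfun_apply blinfun.bilinear_simps)
qed


subsection \<open>The map to AN and its derivative\<close>

text \<open>The scalar q with (2 s i \<phi>(\<xi>))^2 = q: the factors -4 s^2 and -1/8 multiply to
  s^2 / 2.\<close>

definition radial :: "real \<Rightarrow> su2_dual \<Rightarrow> real" where
  "radial s \<xi> = s\<^sup>2 / 2 * ((blinfun_apply \<xi> su2_x)\<^sup>2 + (blinfun_apply \<xi> su2_y)\<^sup>2
     + (blinfun_apply \<xi> su2_t)\<^sup>2)"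

text \<open>The prefactor is 2 s times the normalization 1 / (2 sqrt 2) of the basis.\<close>

definition exp_factor :: "real \<Rightarrow> su2_dual \<Rightarrow> real" where
  "exp_factor s \<xi> = s / sqrt 2 * sinhc_sqrt (radial s \<xi>)"

definition exp11 :: "real \<Rightarrow> su2_dual \<Rightarrow> real" where
  "exp11 s \<xi> = cosh_sqrt (radial s \<xi>) - exp_factor s \<xi> * blinfun_apply \<xi> su2_t"

definition exp22 :: "real \<Rightarrow> su2_dual \<Rightarrow> real" where
  "exp22 s \<xi> = cosh_sqrt (radial s \<xi>) + exp_factor s \<xi> * blinfun_apply \<xi> su2_t"

definition exp12 :: "real \<Rightarrow> su2_dual \<Rightarrow> complex" where
  "exp12 s \<xi> = exp_factor s \<xi> *\<^sub>R Complex (- blinfun_apply \<xi> su2_y) (blinfun_apply \<xi> su2_x)"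

lemma mexp_entries:
  "mexp (cscale (2 * complex_of_real s * \<i>) (mat_of (\<phi> \<xi>)))
     = mat2 (of_real (exp11 s \<xi>)) (exp12 s \<xi>) (cnj (exp12 s \<xi>)) (of_real (exp22 s \<xi>))"
proof -
  define c where "c = s / sqrt 2"
  define p where "p = blinfun_apply \<xi> su2_x"
  define q where "q = blinfun_apply \<xi> su2_y"
  define r where "r = blinfun_apply \<xi> su2_t"
  have A: "cscale (2 * complex_of_real s * \<i>) (mat_of (\<phi> \<xi>))
      = c *\<^sub>R mat2 (- r) (Complex (- q) p) (Complex (- q) (- p)) r"
    by (simp add: vec_eq_iff forall_2 cscale_def \<phi>_def plus_su2.rep_eq scaleR_su2.rep_eq mat_of_basis
        c_def p_def q_def r_def complex_eq_iff field_simps)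
  have "radial s \<xi> = c\<^sup>2 * (p\<^sup>2 + q\<^sup>2 + r\<^sup>2)"
    by (simp add: radial_def c_def p_def q_def r_def power_divide)
  then have "cscale (2 * complex_of_real s * \<i>) (mat_of (\<phi> \<xi>)) 
      ** cscale (2 * complex_of_real s * \<i>) (mat_of (\<phi> \<xi>)) = radial s \<xi> *\<^sub>R mat 1"
    unfolding A
    by (simp add: vec_eq_iff forall_2 matrix_matrix_mult_def sum_2 mat_def complex_eq_iff
        power2_eq_square algebra_simps)
  from mexp_square_scalar[OF this]
  have "mexp (cscale (2 * complex_of_real s * \<i>) (mat_of (\<phi> \<xi>))) = cosh_sqrt (radial s \<xi>) *\<^sub>R mat 1
      + sinhc_sqrt (radial s \<xi>) *\<^sub>R c *\<^sub>R mat2 (- r) (Complex (- q) p) (Complex (- q) (- p)) r"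
    unfolding A .
  also have "\<dots> = mat2 (of_real (exp11 s \<xi>)) (exp12 s \<xi>) (cnj (exp12 s \<xi>)) (of_real (exp22 s \<xi>))"
    by (simp add: vec_eq_iff forall_2 mat_def exp11_def exp12_def exp22_def exp_factor_def
        complex_eq_iff c_def p_def q_def r_def)
  finally show ?thesis .
qed

lemma exp_det: "exp11 s \<xi> * exp22 s \<xi> - (cmod (exp12 s \<xi>))\<^sup>2 = 1"
proof -
  have "exp11 s \<xi> * exp22 s \<xi> - (cmod (exp12 s \<xi>))\<^sup>2
      = (cosh_sqrt (radial s \<xi>))\<^sup>2 - radial s \<xi> * (sinhc_sqrt (radial s \<xi>))\<^sup>2"
    unfolding radial_def[of s \<xi>, THEN arg_cong, of "\<lambda>r. r * _"] cmod_power2 exp12_def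
    by (simp add: exp11_def exp22_def exp_factor_def power2_eq_square algebra_simps)
  then show ?thesis
    by (simp add: cosh_sqrt_sinhc_sqrt)
qed

text \<open>The product 1 + |exp12|^2 and the sum 2 C are both positive. This justifies the square
  roots in the formulas for \<open>E_map\<close>.\<close>

lemma exp_diag_pos: "0 < exp11 s \<xi>" "0 < exp22 s \<xi>"
proof -
  have "0 \<le> radial s \<xi>"
    by (simp add: radial_def)
  then have C: "0 < cosh_sqrt (radial s \<xi>)"
    by (rule cosh_sqrt_pos)
  have "exp11 s \<xi> * exp22 s \<xi> = 1 + (cmod (exp12 s \<xi>))\<^sup>2"
    using exp_det[of s \<xi>] by simp
  then have "0 < exp11 s \<xi> * exp22 s \<xi>"
    by (simp add: add_pos_nonneg)
  moreover have "0 < exp11 s \<xi> + exp22 s \<xi>"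
    using C by (simp add: exp11_def exp22_def)
  ultimately show "0 < exp11 s \<xi>" "0 < exp22 s \<xi>"
    by (auto simp: zero_less_mult_iff)
qed

section \<open>The two conventions for f on AN and their inverses\<close>

lemma AN_cases:
  assumes "b \<in> AN"
  obtains a z where "0 < a" "b = mat2 (complex_of_real a) z 0 (of_real (inverse a))"
proof -
  define a d where "a = Re (b $ 1 $ 1)" and "d = Re (b $ 2 $ 2)"
  then have ad: "b $ 1 $ 1 = of_real a" "b $ 2 $ 2 = of_real d"
    using assms by (auto simp: AN_def)
  moreover from assms have "0 < a"
    by (simp add: AN_def a_def)
  moreover from assms ad have "b $ 2 $ 1 = 0" "complex_of_real (a * d) = of_real 1"
    by (auto simp: AN_def det_2)
  moreover from this have "d = inverse a"
    unfolding of_real_eq_iff by (metis inverse_unique)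
  ultimately show thesis
    using ad by (intro that[of a "b $ 1 $ 2"]) (auto simp: vec_eq_iff forall_2)
qed

lemma mat2_in_AN: "0 < a \<Longrightarrow> mat2 (of_real a) z 0 (of_real (inverse a)) \<in> AN"
  by (auto simp: AN_def det_2 forall_2)

lemma mat2_eq_iff: "mat2 p q r w = mat2 p' q' r' w' \<longleftrightarrow> p = p' \<and> q = q' \<and> r = r' \<and> w = w'"
  by (auto simp: vec_eq_iff forall_2)

lemma herm_square_mat2:
  "herm_square (mat2 (of_real a) z 0 (of_real d)) =
     mat2 (of_real (a\<^sup>2 + (cmod z)\<^sup>2)) (d *\<^sub>R z) (d *\<^sub>R cnj z) (of_real (d\<^sup>2))"
  "herm_square' (mat2 (of_real a) z 0 (of_real d)) =
     mat2 (of_real (a\<^sup>2)) (a *\<^sub>R z) (a *\<^sub>R cnj z) (of_real ((cmod z)\<^sup>2 + d\<^sup>2))"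
  unfolding cmod_power2
  by (simp_all add: herm_square_def herm_square'_def vec_eq_iff forall_2 conj_transpose_def
      matrix_matrix_mult_def sum_2 complex_eq_iff power2_eq_square algebra_simps)

text \<open>The (2,2) entry determines a > 0, then the (1,2) entry determines z. For
  \<open>herm_square'\<close> the (1,1) entry takes the first role.\<close>

lemma inj_on_herm_square: "inj_on herm_square AN"
proof (rule inj_onI)
  fix b b' assume "b \<in> AN" "b' \<in> AN" and e: "herm_square b = herm_square b'"
  then obtain a z a' z' where a: "0 < a" "0 < a'"
    and b: "b = mat2 (of_real a) z 0 (of_real (inverse a))"
      "b' = mat2 (of_real a') z' 0 (of_real (inverse a'))"
    by (meson AN_cases)
  have "inverse a ^ 2 = inverse a' ^ 2" "inverse a *\<^sub>R z = inverse a' *\<^sub>R z'"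
    using e unfolding b herm_square_mat2 mat2_eq_iff of_real_eq_iff by auto
  moreover from this(1) a have "a = a'"
    by simp
  ultimately show "b = b'"
    using a by (simp add: b)
qed

lemma inj_on_herm_square': "inj_on herm_square' AN"
proof (rule inj_onI)
  fix b b' assume "b \<in> AN" "b' \<in> AN" and e: "herm_square' b = herm_square' b'"
  then obtain a z a' z' where a: "0 < a" "0 < a'"
    and b: "b = mat2 (of_real a) z 0 (of_real (inverse a))"
      "b' = mat2 (of_real a') z' 0 (of_real (inverse a'))"
    by (meson AN_cases)
  have "a ^ 2 = a' ^ 2" "a *\<^sub>R z = a' *\<^sub>R z'"
    using e unfolding b herm_square_mat2 mat2_eq_iff of_real_eq_iff by auto
  moreover from this(1) a have "a = a'"
    by simp
  ultimately show "b = b'"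
    using a by (simp add: b)
qed

text \<open>A Cholesky factorization started at the lower right corner. The double inverse keeps the
  shape that \<open>pullback_MC_upper_triangular\<close> expects.\<close>

lemma E_map_herm_square:
  "E_map herm_square s \<xi> = mat2 (of_real (inverse (sqrt (exp22 s \<xi>))))
     (inverse (sqrt (exp22 s \<xi>)) *\<^sub>R exp12 s \<xi>) 0 (of_real (inverse (inverse (sqrt (exp22 s \<xi>)))))"
proof -
  define a where "a = inverse (sqrt (exp22 s \<xi>))"
  have p: "0 < exp11 s \<xi>" "0 < exp22 s \<xi>"
    by (rule exp_diag_pos)+
  have a: "0 < a" "a\<^sup>2 = inverse (exp22 s \<xi>)"
    using p by (simp_all add: a_def power_inverse)
  \<comment> \<open>Determinant one gives a^2 (1 + |exp12|^2) = a^2 exp11 exp22 = exp11.\<close>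
  have "exp11 s \<xi> = a\<^sup>2 + (cmod (a *\<^sub>R exp12 s \<xi>))\<^sup>2"
    using exp_det[of s \<xi>] p by (simp add: power_mult_distrib a field_simps)
  moreover have "exp22 s \<xi> = (inverse a)\<^sup>2"
    using p by (simp add: power_inverse a)
  ultimately have "herm_square (mat2 (of_real a) (a *\<^sub>R exp12 s \<xi>) 0 (of_real (inverse a)))
      = mat2 (of_real (exp11 s \<xi>)) (exp12 s \<xi>) (cnj (exp12 s \<xi>)) (of_real (exp22 s \<xi>))"
    using a(1) unfolding herm_square_mat2 mat2_eq_iff by simp
  then show ?thesis
    unfolding E_map_def mexp_entries a_def[symmetric]
    by (intro inv_into_f_eq inj_on_herm_square mat2_in_AN a(1))
qed

lemma E_map_herm_square':
  "E_map herm_square' s \<xi> = mat2 (of_real (sqrt (exp11 s \<xi>)))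
     (inverse (sqrt (exp11 s \<xi>)) *\<^sub>R exp12 s \<xi>) 0 (of_real (inverse (sqrt (exp11 s \<xi>))))"
proof -
  define a where "a = sqrt (exp11 s \<xi>)"
  have p: "0 < exp11 s \<xi>" "0 < exp22 s \<xi>"
    by (rule exp_diag_pos)+
  have a: "0 < a" "a\<^sup>2 = exp11 s \<xi>"
    using p by (simp_all add: a_def)
  have "exp22 s \<xi> = (cmod (inverse a *\<^sub>R exp12 s \<xi>))\<^sup>2 + (inverse a)\<^sup>2"
    using exp_det[of s \<xi>] p by (simp add: power_mult_distrib power_inverse a field_simps)
  then have "herm_square' (mat2 (of_real a) (inverse a *\<^sub>R exp12 s \<xi>) 0 (of_real (inverse a)))
      = mat2 (of_real (exp11 s \<xi>)) (exp12 s \<xi>) (cnj (exp12 s \<xi>)) (of_real (exp22 s \<xi>))"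
    using a unfolding herm_square_mat2 mat2_eq_iff by simp
  then show ?thesis
    unfolding E_map_def mexp_entries a_def[symmetric]
    by (intro inv_into_f_eq inj_on_herm_square' mat2_in_AN a(1))
qed

section \<open>Derivatives in coadjoint directions\<close>

text \<open>The condition on \<eta> is tangency to the sphere through \<xi>, which holds for
  coadjoint vectors.\<close>

lemma exp_entries_deriv:
  obtains d11 d22 d12 where
    "(exp11 s has_derivative d11) (at \<xi>)" "(exp22 s has_derivative d22) (at \<xi>)"
    "(exp12 s has_derivative d12) (at \<xi>)"
    "\<And>\<eta>. blinfun_apply \<xi> su2_x * blinfun_apply \<eta> su2_x + blinfun_apply \<xi> su2_y * blinfun_apply \<eta> su2_y
        + blinfun_apply \<xi> su2_t * blinfun_apply \<eta> su2_t = 0 \<Longrightarrow>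
      d11 \<eta> = - (exp_factor s \<xi> * blinfun_apply \<eta> su2_t) \<and> d22 \<eta> = exp_factor s \<xi> * blinfun_apply \<eta> su2_t
      \<and> d12 \<eta> = exp_factor s \<xi> *\<^sub>R Complex (- blinfun_apply \<eta> su2_y) (blinfun_apply \<eta> su2_x)"
proof -
  define dr where "dr \<eta> = s\<^sup>2 * (blinfun_apply \<xi> su2_x * blinfun_apply \<eta> su2_x
    + blinfun_apply \<xi> su2_y * blinfun_apply \<eta> su2_y + blinfun_apply \<xi> su2_t * blinfun_apply \<eta> su2_t)" for \<eta> :: su2_dual
  have r: "(radial s has_derivative dr) (at \<xi>)"
    unfolding radial_def[abs_def] dr_def[abs_def]
    by (auto intro!: derivative_eq_intros simp: fun_eq_iff algebra_simps)
  obtain d where d: "(sinhc_sqrt has_field_derivative d) (at (radial s \<xi>))"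
    by (rule sinhc_sqrt_deriv)
  define dF where "dF \<eta> = s / sqrt 2 * (dr \<eta> * d)" for \<eta>
  have C: "((\<lambda>\<xi>. cosh_sqrt (radial s \<xi>)) has_derivative (\<lambda>\<eta>. dr \<eta> * (sinhc_sqrt (radial s \<xi>) / 2))) (at \<xi>)"
    by (rule DERIV_compose_FDERIV[OF cosh_sqrt_deriv r])
  have "((\<lambda>\<xi>. sinhc_sqrt (radial s \<xi>)) has_derivative (\<lambda>\<eta>. dr \<eta> * d)) (at \<xi>)"
    by (rule DERIV_compose_FDERIV[OF d r])
  then have F: "(exp_factor s has_derivative dF) (at \<xi>)"
    unfolding exp_factor_def[abs_def] dF_def[abs_def] by (rule has_derivative_mult_right)
  let ?z = "\<lambda>\<eta>. Complex (- blinfun_apply \<eta> su2_y) (blinfun_apply \<eta> su2_x)"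
  have z: "(?z has_derivative ?z) (at \<xi>)"
    unfolding Complex_eq by (auto intro!: derivative_eq_intros)
  let ?d = "\<lambda>\<eta>. dF \<eta> * blinfun_apply \<xi> su2_t + exp_factor s \<xi> * blinfun_apply \<eta> su2_t"
  have "(exp11 s has_derivative (\<lambda>\<eta>. dr \<eta> * (sinhc_sqrt (radial s \<xi>) / 2) - ?d \<eta>)) (at \<xi>)"
    "(exp22 s has_derivative (\<lambda>\<eta>. dr \<eta> * (sinhc_sqrt (radial s \<xi>) / 2) + ?d \<eta>)) (at \<xi>)"
    unfolding exp11_def[abs_def] exp22_def[abs_def]
    by (auto intro!: derivative_eq_intros C F)
  moreover have "(exp12 s has_derivative (\<lambda>\<eta>. exp_factor s \<xi> *\<^sub>R ?z \<eta> + dF \<eta> *\<^sub>R ?z \<xi>)) (at \<xi>)"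
    unfolding exp12_def[abs_def] by (rule has_derivative_scaleR[OF F z])
  ultimately show thesis
    \<comment> \<open>Tangency gives \<open>dr \<eta> = 0\<close> and hence
      \<open>dF \<eta> = 0\<close>; only the linear coordinates still vary.\<close>
    by (rule that) (simp add: dr_def dF_def)
qed

lemma upper_triangular_deriv:
  assumes "(\<alpha> has_derivative \<alpha>') (at \<xi>)" "(g has_derivative g') (at \<xi>)" "\<alpha> \<xi> \<noteq> 0"
  shows "((\<lambda>\<xi>. mat2 (of_real (\<alpha> \<xi>)) (g \<xi>) 0 (of_real (inverse (\<alpha> \<xi>)))) has_derivative
    (\<lambda>\<eta>. mat2 (of_real (\<alpha>' \<eta>)) (g' \<eta>) 0 (of_real (- \<alpha>' \<eta> / (\<alpha> \<xi>)\<^sup>2)))) (at \<xi>)"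
proof -
  have bl: "bounded_linear (\<lambda>r::real. mat2 (of_real r) 0 0 0)"
    "bounded_linear (\<lambda>z. mat2 0 z 0 0)" "bounded_linear (\<lambda>r::real. mat2 0 0 0 (of_real r))"
    unfolding linear_conv_bounded_linear[symmetric]
    by (auto intro!: linearI simp: vec_eq_iff forall_2 complex_eq_iff)
  have split: "mat2 p q 0 w = mat2 p 0 0 0 + mat2 0 q 0 0 + mat2 0 0 0 w" for p q w
    by (simp add: vec_eq_iff forall_2)
  have "((\<lambda>\<xi>. inverse (\<alpha> \<xi>)) has_derivative (\<lambda>\<eta>. - \<alpha>' \<eta> / (\<alpha> \<xi>)\<^sup>2)) (at \<xi>)"
    using assms(3) by (auto intro!: derivative_eq_intros assms(1) simp: fun_eq_iff power2_eq_square field_simps)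
  from has_derivative_add[OF has_derivative_add[OF bounded_linear.has_derivative[OF bl(1) assms(1)]
      bounded_linear.has_derivative[OF bl(2) assms(2)]] bounded_linear.has_derivative[OF bl(3) this]]
  show ?thesis
    unfolding split[symmetric] .
qed

text \<open>The diagonal of b^-1 V is (a'/a, -a'/a), and X22 = -X11, whence the factor 2.\<close>

lemma pairing_MC_left:
  assumes "a \<noteq> 0"
  shows "pairing s (MC_left (mat2 (of_real a) z 0 (of_real (inverse a)))
      (mat2 (of_real a') z' 0 (of_real (- a' / a\<^sup>2)))) (mat_of X)
    = - (4 / s) * Im (of_real (2 * a' / a) * mat_of X $ 1 $ 1
        + (z' /\<^sub>R a + (a' / a\<^sup>2) *\<^sub>R z) * mat_of X $ 2 $ 1)"
proof -
  let ?b = "mat2 (of_real a) z 0 (of_real (inverse a))"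
  let ?c = "mat2 (of_real (inverse a)) (- z) 0 (of_real a)"
  have i: "?b ** ?c = mat 1" "?c ** ?b = mat 1"
    using assms by (simp_all add: mat2_mult vec_eq_iff forall_2 mat_def)
  \<comment> \<open>\<open>matrix_inv\<close> is a choice; being a left inverse, it must agree with
    the explicit right inverse \<open>?c\<close>.\<close>
  have "matrix_inv ?b ** ?b = mat 1"
    unfolding matrix_inv_def by (rule someI2[of _ ?c]) (use i in simp_all)
  then have "matrix_inv ?b ** (?b ** ?c) = ?c"
    by (simp add: matrix_mul_assoc)
  then have "matrix_inv ?b = ?c"
    by (simp only: i matrix_mul_rid)
  then show ?thesis
    using assms
    by (simp add: pairing_def MC_left_def mat2_mult trace_def sum_2 matrix_matrix_mult_def mat_of_entries
        scaleR_conv_of_real power2_eq_square field_simps)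
qed

lemma pullback_MC_upper_triangular:
  assumes E: "\<And>\<xi>. E_map f s \<xi> = mat2 (of_real (\<alpha> \<xi>)) (g \<xi>) 0 (of_real (inverse (\<alpha> \<xi>)))"
    and "(\<alpha> has_derivative \<alpha>') (at \<xi>)" "(g has_derivative g') (at \<xi>)" "\<alpha> \<xi> \<noteq> 0"
  shows "pullback_MC f s X \<xi> \<eta> = - (4 / s) * Im (of_real (2 * \<alpha>' \<eta> / \<alpha> \<xi>) * mat_of X $ 1 $ 1
    + (g' \<eta> /\<^sub>R \<alpha> \<xi> + (\<alpha>' \<eta> / (\<alpha> \<xi>)\<^sup>2) *\<^sub>R g \<xi>) * mat_of X $ 2 $ 1)"
proof -
  have "E_map f s = (\<lambda>\<xi>. mat2 (of_real (\<alpha> \<xi>)) (g \<xi>) 0 (of_real (inverse (\<alpha> \<xi>))))"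
    by (simp add: E fun_eq_iff)
  then have "frechet_derivative (E_map f s) (at \<xi>)
      = (\<lambda>\<eta>. mat2 (of_real (\<alpha>' \<eta>)) (g' \<eta>) 0 (of_real (- \<alpha>' \<eta> / (\<alpha> \<xi>)\<^sup>2)))"
    using frechet_derivative_at[OF upper_triangular_deriv[OF assms(2-4)]] by (simp only:)
  then show ?thesis
    unfolding pullback_MC_def E by (simp only: pairing_MC_left[OF assms(4)])
qed

lemma pullback_MC_herm_square':
  assumes "blinfun_apply \<xi> su2_x * blinfun_apply \<eta> su2_x + blinfun_apply \<xi> su2_y * blinfun_apply \<eta> su2_y
        + blinfun_apply \<xi> su2_t * blinfun_apply \<eta> su2_t = 0"
  shows "pullback_MC herm_square' s X \<xi> \<eta> = 4 * exp_factor s \<xi> / (s * exp11 s \<xi>)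
    * Im (of_real (blinfun_apply \<eta> su2_t) * mat_of X $ 1 $ 1
        - Complex (- blinfun_apply \<eta> su2_y) (blinfun_apply \<eta> su2_x) * mat_of X $ 2 $ 1)"
proof -
  obtain d11 d22 d12 where d: "(exp11 s has_derivative d11) (at \<xi>)" "(exp12 s has_derivative d12) (at \<xi>)"
    and e: "d11 \<eta> = - (exp_factor s \<xi> * blinfun_apply \<eta> su2_t)"
     "d12 \<eta> = exp_factor s \<xi> *\<^sub>R Complex (- blinfun_apply \<eta> su2_y) (blinfun_apply \<eta> su2_x)"
    by (rule exp_entries_deriv[of s \<xi>]) (use assms in blast)
  define a where "a = sqrt (exp11 s \<xi>)"
  have a: "0 < a" "a\<^sup>2 = exp11 s \<xi>"
    using exp_diag_pos[of s \<xi>] by (simp_all add: a_def)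
  have \<alpha>: "((\<lambda>\<xi>. sqrt (exp11 s \<xi>)) has_derivative (\<lambda>\<eta>. d11 \<eta> / (2 * a))) (at \<xi>)"
    using exp_diag_pos[of s \<xi>]
    by (auto intro!: derivative_eq_intros d simp: a_def fun_eq_iff field_simps)
  have "((\<lambda>\<xi>. inverse (sqrt (exp11 s \<xi>))) has_derivative (\<lambda>\<eta>. - (d11 \<eta> / (2 * a ^ 3)))) (at \<xi>)"
    using Deriv.has_derivative_inverse[OF _ \<alpha>] a(1)
    by (simp add: a_def[symmetric] power3_eq_cube field_simps)
  from has_derivative_scaleR[OF this d(2)]
  have g: "((\<lambda>\<xi>. inverse (sqrt (exp11 s \<xi>)) *\<^sub>R exp12 s \<xi>) has_derivative
      (\<lambda>\<eta>. inverse a *\<^sub>R d12 \<eta> + - (d11 \<eta> / (2 * a ^ 3)) *\<^sub>R exp12 s \<xi>)) (at \<xi>)"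
    by (simp add: a_def)
  have "pullback_MC herm_square' s X \<xi> \<eta> =
    - (4 / s) * Im (of_real (2 * (d11 \<eta> / (2 * a)) / a) * mat_of X $ 1 $ 1
    + ((inverse a *\<^sub>R d12 \<eta> + - (d11 \<eta> / (2 * a ^ 3)) *\<^sub>R exp12 s \<xi>) /\<^sub>R a
      + (d11 \<eta> / (2 * a) / a\<^sup>2) *\<^sub>R (inverse a *\<^sub>R exp12 s \<xi>)) * mat_of X $ 2 $ 1)"
    using pullback_MC_upper_triangular[OF E_map_herm_square' \<alpha> g] a(1) unfolding a_def[symmetric] by simp
  \<comment> \<open>The derivative of 1/a inside g cancels the Maurer-Cartan correction, so
    \<open>exp12\<close> itself drops out.\<close>
  also have "(inverse a *\<^sub>R d12 \<eta> + - (d11 \<eta> / (2 * a ^ 3)) *\<^sub>R exp12 s \<xi>) /\<^sub>R a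
      + (d11 \<eta> / (2 * a) / a\<^sup>2) *\<^sub>R (inverse a *\<^sub>R exp12 s \<xi>) = d12 \<eta> /\<^sub>R a\<^sup>2"
    using a(1) by (simp add: complex_eq_iff power2_eq_square power3_eq_cube field_simps)
  also have "2 * (d11 \<eta> / (2 * a)) / a = d11 \<eta> / a\<^sup>2"
    by (simp add: power2_eq_square)
  finally show ?thesis
    unfolding a(2) e by (simp add: divide_inverse algebra_simps
      del: of_real_divide of_real_mult of_real_minus of_real_inverse)
qed

lemma pullback_MC_herm_square:
  assumes "blinfun_apply \<xi> su2_x * blinfun_apply \<eta> su2_x + blinfun_apply \<xi> su2_y * blinfun_apply \<eta> su2_y
        + blinfun_apply \<xi> su2_t * blinfun_apply \<eta> su2_t = 0"
  shows "pullback_MC herm_square s X \<xi> \<eta> = 4 * exp_factor s \<xi> / s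
    * Im (of_real (blinfun_apply \<eta> su2_t / exp22 s \<xi>) * mat_of X $ 1 $ 1
        - (Complex (- blinfun_apply \<eta> su2_y) (blinfun_apply \<eta> su2_x)
           - (blinfun_apply \<eta> su2_t / exp22 s \<xi>) *\<^sub>R exp12 s \<xi>) * mat_of X $ 2 $ 1)"
proof -
  obtain d11 d22 d12 where d: "(exp22 s has_derivative d22) (at \<xi>)" "(exp12 s has_derivative d12) (at \<xi>)"
    and e: "d22 \<eta> = exp_factor s \<xi> * blinfun_apply \<eta> su2_t"
     "d12 \<eta> = exp_factor s \<xi> *\<^sub>R Complex (- blinfun_apply \<eta> su2_y) (blinfun_apply \<eta> su2_x)"
    by (rule exp_entries_deriv[of s \<xi>]) (use assms in blast)
  define a where "a = inverse (sqrt (exp22 s \<xi>))"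
  have a: "0 < a" "a\<^sup>2 = inverse (exp22 s \<xi>)"
    using exp_diag_pos[of s \<xi>] by (simp_all add: a_def power_inverse)
  have "((\<lambda>\<xi>. sqrt (exp22 s \<xi>)) has_derivative (\<lambda>\<eta>. d22 \<eta> * (a / 2))) (at \<xi>)"
    using exp_diag_pos[of s \<xi>]
    by (auto intro!: derivative_eq_intros d simp: a_def fun_eq_iff field_simps)
  from Deriv.has_derivative_inverse[OF _ this] exp_diag_pos[of s \<xi>]
  have \<alpha>: "((\<lambda>\<xi>. inverse (sqrt (exp22 s \<xi>))) has_derivative (\<lambda>\<eta>. - (d22 \<eta> * (a ^ 3 / 2)))) (at \<xi>)"
    by (simp add: a_def[symmetric] power3_eq_cube mult.commute mult.left_commute)
  from has_derivative_scaleR[OF this d(2)]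
  have g: "((\<lambda>\<xi>. inverse (sqrt (exp22 s \<xi>)) *\<^sub>R exp12 s \<xi>) has_derivative
      (\<lambda>\<eta>. a *\<^sub>R d12 \<eta> + - (d22 \<eta> * (a ^ 3 / 2)) *\<^sub>R exp12 s \<xi>)) (at \<xi>)"
    by (simp add: a_def)
  have "pullback_MC herm_square s X \<xi> \<eta> =
    - (4 / s) * Im (of_real (2 * - (d22 \<eta> * (a ^ 3 / 2)) / a) * mat_of X $ 1 $ 1
    + ((a *\<^sub>R d12 \<eta> + - (d22 \<eta> * (a ^ 3 / 2)) *\<^sub>R exp12 s \<xi>) /\<^sub>R a
      + (- (d22 \<eta> * (a ^ 3 / 2)) / a\<^sup>2) *\<^sub>R (a *\<^sub>R exp12 s \<xi>)) * mat_of X $ 2 $ 1)"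
    using pullback_MC_upper_triangular[OF E_map_herm_square \<alpha> g] a(1) unfolding a_def[symmetric] by simp
  \<comment> \<open>Here the two contributions of a' add up instead of cancelling, so a multiple of
    \<open>exp12\<close> survives.\<close>
  also have "(a *\<^sub>R d12 \<eta> + - (d22 \<eta> * (a ^ 3 / 2)) *\<^sub>R exp12 s \<xi>) /\<^sub>R a
      + (- (d22 \<eta> * (a ^ 3 / 2)) / a\<^sup>2) *\<^sub>R (a *\<^sub>R exp12 s \<xi>) = d12 \<eta> - (d22 \<eta> * a\<^sup>2) *\<^sub>R exp12 s \<xi>"
    using a(1) by (simp add: complex_eq_iff power2_eq_square power3_eq_cube field_simps)
  also have "2 * - (d22 \<eta> * (a ^ 3 / 2)) / a = - (d22 \<eta> * a\<^sup>2)"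
    using a(1) by (simp add: power2_eq_square power3_eq_cube)
  finally show ?thesis
    unfolding a(2) e by (simp add: divide_inverse algebra_simps
      del: of_real_divide of_real_mult of_real_minus of_real_inverse)
qed

section \<open>Exclusion of one convention and the final formulas\<close>

lemma exp_factor_pos: "0 < s \<Longrightarrow> 0 < exp_factor s \<xi>"
  by (simp add: exp_factor_def sinhc_sqrt_pos radial_def)

text \<open>This removes the first alternative for \<open>f\<close> in the theorem.\<close>

lemma not_moment_condition_herm_square:
  assumes "0 < s" "two_form \<Omega>"
  shows "\<not> moment_condition herm_square s \<Omega>"
proof
  assume m: "moment_condition herm_square s \<Omega>"
  \<comment> \<open>The contraction with \<open>x\<close> is a nonzero multiple of \<open>\<xi>(x) \<xi>(y)\<close>.\<close>
  define \<xi> where "\<xi> = blinfun_inner_right (su2_x + su2_y)"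
  define \<eta> where "\<eta> = coad_field su2_x \<xi>"
  have \<xi>: "blinfun_apply \<xi> su2_x = 1" "blinfun_apply \<xi> su2_y = 1" "blinfun_apply \<xi> su2_t = 0"
    by (simp_all add: \<xi>_def inner_su2_entries plus_su2.rep_eq basis_entries field_simps)
  have \<eta>: "blinfun_apply \<eta> su2_x = 0" "blinfun_apply \<eta> su2_y = 0" "blinfun_apply \<eta> su2_t = 1 / sqrt 2"
    by (simp_all add: \<eta>_def coad_field_apply bracket_basis blinfun.bilinear_simps \<xi>)
  have "\<Omega> \<xi> \<eta> \<eta> = 0"
    using assms(2) by (simp add: two_form_def)
  moreover have "\<Omega> \<xi> \<eta> \<eta> = pullback_MC herm_square s su2_x \<xi> \<eta>
      - frechet_derivative (\<lambda>\<zeta>. blinfun_apply \<zeta> su2_x) (at \<xi>) \<eta>"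
    using m unfolding moment_condition_def \<eta>_def by blast
  moreover have "pullback_MC herm_square s su2_x \<xi> \<eta> \<noteq> 0"
    using assms(1) exp_factor_pos[OF assms(1), of \<xi>] exp_diag_pos[of s \<xi>]
    by (subst pullback_MC_herm_square) (simp_all add: \<xi> \<eta> mat_of_entries basis_entries exp12_def)
  ultimately show False
    by (simp add: \<eta> frechet_derivative_blinfun_apply)
qed

theorem lemma6p5:
  fixes s a u v :: real
    and lam :: su2_dual
    and f :: "mat2 \<Rightarrow> mat2"
    and \<Omega> :: "su2_dual \<Rightarrow> su2_dual \<Rightarrow> su2_dual \<Rightarrow> real"
  assumes "s > 0"
    and "f = herm_square \<or> f = herm_square'"
    and "closed_two_form \<Omega>"
    and "moment_condition f s \<Omega>"
    and "E_map f s lam = mat2 (of_real a) (of_real u + \<i> * of_real v) 0 (of_real (inverse a))"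
    and "a > 0"
  shows "delinearize \<Omega> \<omega>_can (1, lam) (su2_x, 0) (su2_y, 0)
           = (1 / a\<^sup>2) / (2 * s) * (u\<^sup>2 + v\<^sup>2 - a\<^sup>2 + 1 / a\<^sup>2)
       \<and> delinearize \<Omega> \<omega>_can (1, lam) (su2_y, 0) (su2_t, 0) = inverse a * v / s
       \<and> delinearize \<Omega> \<omega>_can (1, lam) (su2_x, 0) (su2_t, 0) = inverse a * u / s"
proof -
  have f: "f = herm_square'"
    using assms not_moment_condition_herm_square by (auto simp: closed_two_form_def)
  define c where "c = exp_factor s lam"
  define p where "p = blinfun_apply lam su2_x"
  define q where "q = blinfun_apply lam su2_y"
  define r where "r = blinfun_apply lam su2_t"
  note E = assms(5)[unfolded f E_map_herm_square' mat2_eq_iff]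
  have a: "sqrt (exp11 s lam) = a"
    using E of_real_eq_iff by blast
  then have a2: "exp11 s lam = a\<^sup>2"
    using exp_diag_pos(1)[of s lam] by auto
  have "inverse a *\<^sub>R exp12 s lam = of_real u + \<i> * of_real v"
    using E by (simp add: a)
  then have e12: "exp12 s lam = Complex (a * u) (a * v)"
    using assms(6) by (simp add: complex_eq_iff field_simps)
  \<comment> \<open>The real part of \<open>exp12\<close> carries the y-coordinate and the imaginary
    part the x-coordinate, so u goes with q and v with p.\<close>
  then have u: "a * u = - (c * q)" and v: "a * v = c * p"
    by (simp_all add: exp12_def c_def p_def q_def complex_eq_iff)
  have "a\<^sup>2 * exp22 s lam = 1 + a\<^sup>2 * (u\<^sup>2 + v\<^sup>2)"
    using exp_det[of s lam] by (simp add: a2 e12 cmod_power2 power_mult_distrib algebra_simps)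
  then have "exp22 s lam = u\<^sup>2 + v\<^sup>2 + 1 / a\<^sup>2"
    using assms(6) by (simp add: field_simps)
  \<comment> \<open>C cancels in the difference of the diagonal entries, which isolates the
    t-coordinate.\<close>
  moreover have "exp22 s lam - exp11 s lam = 2 * (c * r)"
    by (simp add: exp11_def exp22_def c_def r_def)
  ultimately have r: "2 * (c * r) = u\<^sup>2 + v\<^sup>2 - a\<^sup>2 + 1 / a\<^sup>2"
    by (simp add: a2)
  have two: "sqrt 2 * (sqrt 2 * z) = 2 * z" for z :: real
    by (simp flip: mult.assoc)
  note D = delinearize_one[OF assms(4)[unfolded f]]
  note simps = two coad_field_apply bracket_basis blinfun.bilinear_simps mat_of_entries basis_entries
    a2 c_def[symmetric] p_def[symmetric] q_def[symmetric] r_def[symmetric]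
  \<comment> \<open>The factor 1 / sqrt 2 of the bracket and 1 / (2 sqrt 2) of the basis entry
    cancel the 4 of the pairing. The substitution also leaves the tangency of the coadjoint vector
    to be checked.\<close>
  have "delinearize \<Omega> \<omega>_can (1, lam) (su2_x, 0) (su2_y, 0) = c * r / (s * a\<^sup>2)"
    unfolding D by (subst pullback_MC_herm_square') (simp_all add: simps)
  moreover have "delinearize \<Omega> \<omega>_can (1, lam) (su2_y, 0) (su2_t, 0) = c * p / (s * a\<^sup>2)"
    unfolding D by (subst pullback_MC_herm_square') (simp_all add: simps)
  moreover have "delinearize \<Omega> \<omega>_can (1, lam) (su2_x, 0) (su2_t, 0) = - (c * q) / (s * a\<^sup>2)"
    unfolding D by (subst pullback_MC_herm_square') (simp_all add: simps)
  moreover have "c * r / (s * a\<^sup>2) = (1 / a\<^sup>2) / (2 * s) * (u\<^sup>2 + v\<^sup>2 - a\<^sup>2 + 1 / a\<^sup>2)"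
    by (simp flip: r)
  moreover have "a * v / (s * a\<^sup>2) = inverse a * v / s" "a * u / (s * a\<^sup>2) = inverse a * u / s"
    using assms(1,6) by (simp_all add: power2_eq_square field_simps)
  ultimately show ?thesis
    by (simp only: u[symmetric] v[symmetric])
qed

end
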